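(* Let $q\in(0,1)$ and let $x\ge 0$ be a real number. Then for every real $\alpha\ge 1$, $$(1+x)_q^\alpha \;\ge\; 1+[\alpha]_q\,x,$$ and for every real $\alpha$ with $0<\alpha<1$, $$(1+x)_q^\alpha \;\le\; 1+[\alpha]_q\,x .$$
   Context: For $q\in(0,1)$ and real $\alpha$, $[\alpha]_q=\frac{q^\alpha-1}{q-1}$. For real $x$, $(1+x)_q^\infty=\prod_{j=0}^{\infty}(1+q^j x)$ (a convergent infinite product), and $(1+x)_q^\alpha=\dfrac{(1+x)_q^\infty}{(1+q^\alpha x)_q^\infty}$, where $(1+q^\alpha x)_q^\infty=\prod_{j=0}^\infty(1+q^{j+\alpha}x)$. *)

theory Defs
  imports "HOL-Analysis.Analysis"
begin

definition q_number :: "real \<Rightarrow> real \<Rightarrow> real" where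
  "q_number q \<alpha> = (q powr \<alpha> - 1) / (q - 1)"

text \<open>
  \<open>q_prod_inf q x\<close> and \<open>q_power q \<alpha> x\<close> stand for \<open>(1 + x)\<close> to the power \<open>\<infinity>\<close>,
  respectively \<open>\<alpha>\<close>, with base \<open>q\<close>: the argument is \<open>x\<close>, not \<open>1 + x\<close>.
  They are meaningful for \<open>0 < q < 1\<close>.
\<close>

definition q_prod_inf :: "real \<Rightarrow> real \<Rightarrow> real" where
  "q_prod_inf q x = (\<Prod>j. 1 + q ^ j * x)"

definition q_power :: "real \<Rightarrow> real \<Rightarrow> real \<Rightarrow> real" where
  "q_power q \<alpha> x = q_prod_inf q x / q_prod_inf q (q powr \<alpha> * x)"

lemma convergent_q_prod:
  fixes q x :: real
  assumes "0 < q" "q < 1"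
  shows "convergent_prod (\<lambda>j. 1 + q ^ j * x)"
proof -
  have "summable (\<lambda>j. norm (q ^ j * x))"
    using assms by (auto simp: abs_mult power_abs intro!: summable_mult2 summable_geometric)
  then show ?thesis
    by (intro abs_convergent_prod_imp_convergent_prod summable_imp_abs_convergent_prod) simp
qed

lemma q_prod_inf_shift:
  fixes q \<alpha> x :: real
  assumes "0 < q"
  shows "q_prod_inf q (q powr \<alpha> * x) = (\<Prod>j. 1 + q powr (real j + \<alpha>) * x)"
  using assms by (simp add: q_prod_inf_def powr_add powr_realpow mult.assoc)

end

theory Submission
  imports Defs
begin

text \<open>
  The inequality is a \<open>q\<close>-analogue of Bernoulli's inequality. Put \<open>a = q powr \<alpha>\<close>,
  \<open>c = q_number q \<alpha> = (1 - a) / (1 - q)\<close> and \<open>u j = 1 + c q\<^sup>j x\<close>. The \<open>q\<close>-power is the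
  product over all \<open>j\<close> of the quotients \<open>(1 + q\<^sup>j x) / (1 + q\<^sup>j a x)\<close>, while \<open>1 + c x = u 0\<close> is the
  telescoping product of the quotients \<open>u j / u (j + 1)\<close>, because \<open>u j\<close> tends to \<open>1\<close>. So it
  suffices to compare the two products factor by factor. With \<open>y = q\<^sup>j x\<close>, the choice of \<open>c\<close>
  cancels the linear terms in
  \<open>(1 + y) (1 + c q y) - (1 + a y) (1 + c y) = c (q - a) y\<^sup>2\<close>,
  whose sign is that of \<open>q - a\<close>: nonnegative if \<open>\<alpha> \<ge> 1\<close>, nonpositive if \<open>0 < \<alpha> < 1\<close>.
  The lemma \<open>bernoulli_factor_identity\<close> is this identity, and \<open>prodinf_telescoping_le\<close> is the
  passage from the factors to the infinite products.
\<close>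

text \<open>
  In finite products the hypothesis on the factors telescopes, leaving \<open>u 0\<close> on one side and the
  last \<open>u\<close> on the other; the latter disappears in the limit. Writing \<open>u\<close> as a multiplier instead
  of a quotient makes the lemma usable in both directions, with \<open>u\<close> or with \<open>1 / u\<close>.
\<close>

lemma prodinf_telescoping_le:
  fixes f g u :: "nat \<Rightarrow> real"
  assumes f: "convergent_prod f" "\<And>j. f j \<ge> 0"
    and g: "convergent_prod g" "\<And>j. g j \<ge> 0"
    and u: "u \<longlonglongrightarrow> 1"
    and step: "\<And>j. u j * g j \<le> f j * u (Suc j)"
  shows "u 0 * prodinf g \<le> prodinf f"
proof -
  have partial: "u 0 * (\<Prod>j\<le>n. g j) \<le> (\<Prod>j\<le>n. f j) * u (Suc n)" for n
  proof (induction n)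
    case 0
    then show ?case using step[of 0] by simp
  next
    case (Suc n)
    have "u 0 * (\<Prod>j\<le>Suc n. g j) = (u 0 * (\<Prod>j\<le>n. g j)) * g (Suc n)"
      by simp
    also have "\<dots> \<le> ((\<Prod>j\<le>n. f j) * u (Suc n)) * g (Suc n)"
      using Suc.IH g(2) by (rule mult_right_mono)
    also have "\<dots> = (\<Prod>j\<le>n. f j) * (u (Suc n) * g (Suc n))"
      by simp
    also have "\<dots> \<le> (\<Prod>j\<le>n. f j) * (f (Suc n) * u (Suc (Suc n)))"
      using step f(2) by (intro mult_left_mono prod_nonneg) auto
    finally show ?case by (simp add: mult.assoc)
  qed
  have "(\<lambda>n. u 0 * (\<Prod>j\<le>n. g j)) \<longlonglongrightarrow> u 0 * prodinf g"
    using g(1) by (intro tendsto_intros convergent_prod_LIMSEQ)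
  moreover have "(\<lambda>n. (\<Prod>j\<le>n. f j) * u (Suc n)) \<longlonglongrightarrow> prodinf f * 1"
    using f(1) u by (intro tendsto_mult convergent_prod_LIMSEQ LIMSEQ_Suc)
  ultimately show ?thesis
    using LIMSEQ_le partial by fastforce
qed

lemma q_prod_inf_pos:
  fixes q x :: real
  assumes "0 < q" "q < 1" "x \<ge> 0"
  shows "q_prod_inf q x > 0"
proof -
  have "(\<lambda>n. \<Prod>j\<le>n. 1 + q ^ j * x) \<longlonglongrightarrow> q_prod_inf q x"
    unfolding q_prod_inf_def using convergent_q_prod assms by (intro convergent_prod_LIMSEQ)
  moreover have "1 \<le> (\<Prod>j\<le>n. 1 + q ^ j * x)" for n
    using assms by (intro prod_ge_1) simp
  ultimately have "1 \<le> q_prod_inf q x"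
    by (intro LIMSEQ_le_const) auto
  then show ?thesis by simp
qed

lemma bernoulli_factor_identity:
  fixes a c q y :: real
  assumes "c * (1 - q) = 1 - a"
  shows "(1 + y) * (1 + c * (q * y)) - (1 + c * y) * (1 + a * y) = c * (q - a) * y\<^sup>2"
proof -
  have "(1 + y) * (1 + c * (q * y)) - (1 + c * y) * (1 + a * y)
      = c * (q - a) * y\<^sup>2 + y * ((1 - a) - c * (1 - q))"
    by (simp add: algebra_simps power2_eq_square)
  then show ?thesis using assms by simp
qed

theorem theorem2:
  fixes q x :: real
  assumes "0 < q" and "q < 1" and "x \<ge> 0"
  shows "(\<forall>\<alpha>::real. \<alpha> \<ge> 1 \<longrightarrow> q_power q \<alpha> x \<ge> 1 + q_number q \<alpha> * x) \<and>
         (\<forall>\<alpha>::real. 0 < \<alpha> \<and> \<alpha> < 1 \<longrightarrow> q_power q \<alpha> x \<le> 1 + q_number q \<alpha> * x)"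
proof -
  have both: "(\<alpha> \<ge> 1 \<longrightarrow> 1 + q_number q \<alpha> * x \<le> q_power q \<alpha> x) \<and>
        (\<alpha> < 1 \<longrightarrow> q_power q \<alpha> x \<le> 1 + q_number q \<alpha> * x)" if "\<alpha> > 0" for \<alpha> :: real
  proof -
    define a where "a = q powr \<alpha>"
    define c where "c = q_number q \<alpha>"
    define u where "u j = 1 + c * (q ^ j * x)" for j :: nat
    define f where "f j = 1 + q ^ j * x" for j :: nat
    define g where "g j = 1 + q ^ j * (a * x)" for j :: nat
    have a: "0 < a" "a < 1"
      using assms \<open>\<alpha> > 0\<close> powr_less_mono'[of q 0 \<alpha>] by (auto simp: a_def)
    have c: "c * (1 - q) = 1 - a"
      using assms unfolding c_def q_number_def a_def by (simp add: field_simps)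
    have "c \<ge> 0"
      unfolding c_def q_number_def using assms a by (simp add: a_def divide_nonpos_neg)
    have conv: "convergent_prod f" "convergent_prod g"
      unfolding f_def g_def using convergent_q_prod assms by auto
    have nonneg: "f j \<ge> 0" "g j \<ge> 0" for j
      unfolding f_def g_def using assms a by auto
    have upos: "u j > 0" for j
      unfolding u_def using assms \<open>c \<ge> 0\<close> by (intro add_pos_nonneg) auto
    have qlim: "(\<lambda>j. q ^ j) \<longlonglongrightarrow> 0"
      using assms by (intro LIMSEQ_realpow_zero) auto
    have "u \<longlonglongrightarrow> 1 + c * (0 * x)"
      unfolding u_def by (intro tendsto_add tendsto_mult tendsto_const qlim)
    then have ulim: "u \<longlonglongrightarrow> 1" by simp
    have factor: "f j * u (Suc j) - u j * g j = c * (q - a) * (q ^ j * x)\<^sup>2" for j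
      using bernoulli_factor_identity[OF c, of "q ^ j * x"]
      unfolding f_def g_def u_def by (simp add: mult_ac)
    have F: "q_prod_inf q x = prodinf f" and G: "q_prod_inf q (a * x) = prodinf g"
      unfolding q_prod_inf_def f_def g_def by simp_all
    have Gpos: "prodinf g > 0"
      using q_prod_inf_pos[of q "a * x"] assms a G by simp
    have power: "q_power q \<alpha> x = prodinf f / prodinf g"
      using F G by (simp add: q_power_def a_def)
    have u0: "u 0 = 1 + c * x" by (simp add: u_def)
    have lower: "1 + c * x \<le> q_power q \<alpha> x" if "\<alpha> \<ge> 1"
    proof -
      have "a \<le> q"
        using assms that powr_mono'[of 1 \<alpha> q] by (simp add: a_def)
      then have "0 \<le> c * (q - a) * (q ^ j * x)\<^sup>2" for j
        using \<open>c \<ge> 0\<close> by simp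
      then have "u j * g j \<le> f j * u (Suc j)" for j
        using factor[of j] by (metis diff_ge_0_iff_ge)
      then have "u 0 * prodinf g \<le> prodinf f"
        using conv nonneg ulim by (intro prodinf_telescoping_le)
      then show ?thesis
        using Gpos u0 power by (simp add: pos_le_divide_eq)
    qed
    have upper: "q_power q \<alpha> x \<le> 1 + c * x" if "\<alpha> < 1"
    proof -
      have "q \<le> a"
        using assms that powr_mono'[of \<alpha> 1 q] by (simp add: a_def)
      then have "c * (q - a) * (q ^ j * x)\<^sup>2 \<le> 0" for j
        using \<open>c \<ge> 0\<close> by (intro mult_nonpos_nonneg mult_nonneg_nonpos) auto
      then have "f j * u (Suc j) \<le> u j * g j" for j
        using factor[of j] by (metis diff_le_0_iff_le)
      then have "1 / u j * f j \<le> g j * (1 / u (Suc j))" for j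
        using upos[of j] upos[of "Suc j"] by (simp add: field_simps)
      moreover have "(\<lambda>j. 1 / u j) \<longlonglongrightarrow> 1"
        using tendsto_divide[OF tendsto_const ulim, of 1] by simp
      ultimately have "1 / u 0 * prodinf f \<le> prodinf g"
        using conv nonneg by (intro prodinf_telescoping_le[where u = "\<lambda>j. 1 / u j"])
      then have "prodinf f \<le> u 0 * prodinf g"
        using upos[of 0] by (simp add: pos_divide_le_eq mult.commute)
      then show ?thesis
        using Gpos u0 power by (simp add: pos_divide_le_eq)
    qed
    show ?thesis using lower upper by (simp add: c_def)
  qed
  show ?thesis using both by auto
qed

end
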